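(* Let $(\mathcal A,\delta)$ be a $C^*$-dynamical system. The set $\mathcal M(\mathcal A)$ with the operations of entrywise addition, entrywise scalar multiplication, the involution $(a^* )_{m,n}=a_{n,m}^*$ and the multiplication $$a\star b=a\cdot\sum_{j=0}^\infty\Lambda^j(b)+\sum_{j=1}^\infty\Lambda^j(a)\cdot b$$ is an (associative) algebra with involution.
   Context: A $C^*$-dynamical system $(\mathcal A,\delta)$ is a unital $C^*$-algebra $\mathcal A$ with a $*$-endomorphism $\delta:\mathcal A\to\mathcal A$ (not assumed unital or injective). $\mathbb N=\{0,1,2,\dots\}$. $\mathcal M(\mathcal A)$ is the set of infinite matrices $\{a_{ij}\}_{i,j\in\mathbb N}$ with $a_{ij}\in\delta^i(1)\mathcal A\delta^j(1)$ for all $i,j$ and only finitely many non-zero entries. The symbol $\cdot$ denotes the usual matrix product. The map $\Lambda:\mathcal M(\mathcal A)\to\mathcal M(\mathcal A)$ is given by $\Lambda(a)_{ij}=\delta(a_{i-1,j-1})$ for $i,j\ge1$ and $\Lambda(a)_{ij}=0$ otherwise; $\Lambda^0$ is the identity. (Only finitely many terms of the sums $\sum_j a\cdot\Lambda^j(b)$ and $\sum_j\Lambda^j(a)\cdot b$ are non-zero.) *)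

theory Defs
  imports Complex_Main "HOL-Library.Groups_Big_Fun"
begin

section \<open>Unital C*-algebras\<close>

text \<open>
  The axiom \<open>0 \<noteq> 1\<close> is not imposed, so the zero algebra is included.  For this reason the
  class is not based on \<open>ring_1\<close>.
\<close>

class unital_cstar_algebra = real_normed_algebra + banach + monoid_mult +
  fixes scaleC :: "complex \<Rightarrow> 'a \<Rightarrow> 'a"  (infixr \<open>*\<^sub>C\<close> 75)
    and adj :: "'a \<Rightarrow> 'a"
  assumes scaleR_scaleC: "r *\<^sub>R x = complex_of_real r *\<^sub>C x"
    and scaleC_add_right: "c *\<^sub>C (x + y) = c *\<^sub>C x + c *\<^sub>C y"
    and scaleC_add_left: "(c + d) *\<^sub>C x = c *\<^sub>C x + d *\<^sub>C x"
    and scaleC_scaleC: "c *\<^sub>C (d *\<^sub>C x) = (c * d) *\<^sub>C x"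
    and scaleC_one: "1 *\<^sub>C x = x"
    and mult_scaleC_left: "(c *\<^sub>C x) * y = c *\<^sub>C (x * y)"
    and mult_scaleC_right: "x * (c *\<^sub>C y) = c *\<^sub>C (x * y)"
    and norm_scaleC: "norm (c *\<^sub>C x) = cmod c * norm x"
    and adj_adj: "adj (adj x) = x"
    and adj_add: "adj (x + y) = adj x + adj y"
    and adj_scaleC: "adj (c *\<^sub>C x) = cnj c *\<^sub>C adj x"
    and adj_mult: "adj (x * y) = adj y * adj x"
    and cstar_identity: "norm (adj x * x) = (norm x)\<^sup>2"

instantiation complex :: unital_cstar_algebra
begin

definition scaleC_complex :: "complex \<Rightarrow> complex \<Rightarrow> complex"
  where "scaleC_complex c x = c * x"

definition adj_complex :: "complex \<Rightarrow> complex"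
  where "adj_complex = cnj"

instance
  by standard
    (simp_all add: scaleC_complex_def adj_complex_def algebra_simps scaleR_conv_of_real
      norm_mult power2_eq_square)

end

locale cstar_dynamical_system =
  fixes \<delta> :: "'a::unital_cstar_algebra \<Rightarrow> 'a"
  assumes \<delta>_add: "\<delta> (x + y) = \<delta> x + \<delta> y"
    and \<delta>_scaleC: "\<delta> (c *\<^sub>C x) = c *\<^sub>C \<delta> x"
    and \<delta>_mult: "\<delta> (x * y) = \<delta> x * \<delta> y"
    and \<delta>_adj: "\<delta> (adj x) = adj (\<delta> x)"


section \<open>Algebras with involution\<close>

text \<open>
  Associative complex algebras with involution on an explicit carrier; a unit is not required.
\<close>

locale involutive_algebra =
  fixes M :: "'m set"
    and add :: "'m \<Rightarrow> 'm \<Rightarrow> 'm"  (infixl \<open>\<oplus>\<close> 65)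
    and zero :: 'm  (\<open>\<zero>\<close>)
    and scale :: "complex \<Rightarrow> 'm \<Rightarrow> 'm"  (infixr \<open>\<odot>\<close> 75)
    and mult :: "'m \<Rightarrow> 'm \<Rightarrow> 'm"  (infixl \<open>\<otimes>\<close> 70)
    and inv :: "'m \<Rightarrow> 'm"
  assumes add_closed: "\<lbrakk>a \<in> M; b \<in> M\<rbrakk> \<Longrightarrow> a \<oplus> b \<in> M"
    and zero_closed: "\<zero> \<in> M"
    and scale_closed: "a \<in> M \<Longrightarrow> s \<odot> a \<in> M"
    and mult_closed: "\<lbrakk>a \<in> M; b \<in> M\<rbrakk> \<Longrightarrow> a \<otimes> b \<in> M"
    and inv_closed: "a \<in> M \<Longrightarrow> inv a \<in> M"
    and add_assoc: "\<lbrakk>a \<in> M; b \<in> M; c \<in> M\<rbrakk> \<Longrightarrow> (a \<oplus> b) \<oplus> c = a \<oplus> (b \<oplus> c)"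
    and add_commute: "\<lbrakk>a \<in> M; b \<in> M\<rbrakk> \<Longrightarrow> a \<oplus> b = b \<oplus> a"
    and add_zero: "a \<in> M \<Longrightarrow> a \<oplus> \<zero> = a"
    and add_inverse: "a \<in> M \<Longrightarrow> \<exists>b\<in>M. a \<oplus> b = \<zero>"
    and scale_add_right: "\<lbrakk>a \<in> M; b \<in> M\<rbrakk> \<Longrightarrow> s \<odot> (a \<oplus> b) = (s \<odot> a) \<oplus> (s \<odot> b)"
    and scale_add_left: "a \<in> M \<Longrightarrow> (s + t) \<odot> a = (s \<odot> a) \<oplus> (t \<odot> a)"
    and scale_scale: "a \<in> M \<Longrightarrow> s \<odot> (t \<odot> a) = (s * t) \<odot> a"
    and scale_one: "a \<in> M \<Longrightarrow> 1 \<odot> a = a"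
    and mult_assoc: "\<lbrakk>a \<in> M; b \<in> M; c \<in> M\<rbrakk> \<Longrightarrow> (a \<otimes> b) \<otimes> c = a \<otimes> (b \<otimes> c)"
    and mult_add_right: "\<lbrakk>a \<in> M; b \<in> M; c \<in> M\<rbrakk> \<Longrightarrow> a \<otimes> (b \<oplus> c) = (a \<otimes> b) \<oplus> (a \<otimes> c)"
    and mult_add_left: "\<lbrakk>a \<in> M; b \<in> M; c \<in> M\<rbrakk> \<Longrightarrow> (a \<oplus> b) \<otimes> c = (a \<otimes> c) \<oplus> (b \<otimes> c)"
    and mult_scale_left: "\<lbrakk>a \<in> M; b \<in> M\<rbrakk> \<Longrightarrow> (s \<odot> a) \<otimes> b = s \<odot> (a \<otimes> b)"
    and mult_scale_right: "\<lbrakk>a \<in> M; b \<in> M\<rbrakk> \<Longrightarrow> a \<otimes> (s \<odot> b) = s \<odot> (a \<otimes> b)"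
    and inv_inv: "a \<in> M \<Longrightarrow> inv (inv a) = a"
    and inv_add: "\<lbrakk>a \<in> M; b \<in> M\<rbrakk> \<Longrightarrow> inv (a \<oplus> b) = inv a \<oplus> inv b"
    and inv_scale: "a \<in> M \<Longrightarrow> inv (s \<odot> a) = cnj s \<odot> inv a"
    and inv_mult: "\<lbrakk>a \<in> M; b \<in> M\<rbrakk> \<Longrightarrow> inv (a \<otimes> b) = inv b \<otimes> inv a"


section \<open>Infinite matrices over a C*-dynamical system\<close>

type_synonym 'a imat = "nat \<Rightarrow> nat \<Rightarrow> 'a"

definition Mat :: "('a::unital_cstar_algebra \<Rightarrow> 'a) \<Rightarrow> 'a imat set" where
  "Mat \<delta> = {a. (\<forall>i j. \<exists>x. a i j = (\<delta> ^^ i) 1 * x * (\<delta> ^^ j) 1) \<and>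
               finite {(i, j). a i j \<noteq> 0}}"

definition imat_add :: "'a::unital_cstar_algebra imat \<Rightarrow> 'a imat \<Rightarrow> 'a imat" where
  "imat_add a b = (\<lambda>m n. a m n + b m n)"

definition imat_zero :: "'a::unital_cstar_algebra imat" where
  "imat_zero = (\<lambda>m n. 0)"

definition imat_scale :: "complex \<Rightarrow> 'a::unital_cstar_algebra imat \<Rightarrow> 'a imat" where
  "imat_scale c a = (\<lambda>m n. c *\<^sub>C a m n)"

definition imat_adj :: "'a::unital_cstar_algebra imat \<Rightarrow> 'a imat" where
  "imat_adj a = (\<lambda>m n. adj (a n m))"

text \<open>
  \<^const>\<open>Sum_any\<close> is the sum of a family with finite support.  In the product below the support
  is finite as soon as one of the factors has finitely many non-zero entries.
\<close>

definition imat_mult :: "'a::unital_cstar_algebra imat \<Rightarrow> 'a imat \<Rightarrow> 'a imat" where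
  "imat_mult a b = (\<lambda>m n. Sum_any (\<lambda>k. a m k * b k n))"

definition Lam :: "('a::unital_cstar_algebra \<Rightarrow> 'a) \<Rightarrow> 'a imat \<Rightarrow> 'a imat" where
  "Lam \<delta> a = (\<lambda>i j. if 1 \<le> i \<and> 1 \<le> j then \<delta> (a (i - 1) (j - 1)) else 0)"

text \<open>
  Sums of matrices are entrywise.  The matrix \<open>\<Sum>\<^sub>j \<Lambda>\<^sup>j(b)\<close> need not have finitely many non-zero
  entries, but its entry at \<open>(m, n)\<close> only involves the terms with \<open>j \<le> min m n\<close>.
\<close>

definition imat_star :: "('a::unital_cstar_algebra \<Rightarrow> 'a) \<Rightarrow> 'a imat \<Rightarrow> 'a imat \<Rightarrow> 'a imat" where
  "imat_star \<delta> a b =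
     imat_add
       (imat_mult a (\<lambda>m n. Sum_any (\<lambda>j. (Lam \<delta> ^^ j) b m n)))
       (\<lambda>m n. Sum_any (\<lambda>j. if 1 \<le> j then imat_mult ((Lam \<delta> ^^ j) a) b m n else 0))"

context cstar_dynamical_system
begin

lemma \<delta>_zero: "\<delta> 0 = 0"
  using \<delta>_add[of 0 0] by simp

lemma Lam_pow_eq_0:
  "m < j \<or> n < j \<Longrightarrow> (Lam \<delta> ^^ j) a m n = 0"
proof (induction j arbitrary: m n)
  case (Suc j)
  have "(Lam \<delta> ^^ j) a (m - 1) (n - 1) = 0" if "1 \<le> m" "1 \<le> n"
    by (rule Suc.IH) (use Suc.prems that in linarith)
  then show ?case by (simp add: Lam_def[of \<delta> "(Lam \<delta> ^^ j) a"] \<delta>_zero)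
qed simp

lemma Mat_bounded:
  assumes "a \<in> Mat \<delta>"
  obtains N where "\<And>i j. i \<ge> N \<or> j \<ge> N \<Longrightarrow> a i j = 0"
proof -
  have fin: "finite {(i, j). a i j \<noteq> 0}"
    using assms by (simp add: Mat_def)
  have "finite (fst ` {(i, j). a i j \<noteq> 0} \<union> snd ` {(i, j). a i j \<noteq> 0})"
    using fin by blast
  then obtain N where N: "\<And>k. k \<in> fst ` {(i, j). a i j \<noteq> 0} \<union> snd ` {(i, j). a i j \<noteq> 0} \<Longrightarrow> k < N"
    using finite_nat_set_iff_bounded by meson
  show thesis
  proof (rule that[of N])
    fix i j assume *: "i \<ge> N \<or> j \<ge> N"
    show "a i j = 0"
    proof (rule ccontr)
      assume "a i j \<noteq> 0"
      then have "(i, j) \<in> {(i, j). a i j \<noteq> 0}" by simp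
      then have "i < N" "j < N"
        using N[of i] N[of j] by force+
      with * show False by simp
    qed
  qed
qed

lemma finite_mult_Lam_pow:
  assumes "a \<in> Mat \<delta>"
  shows "finite {j. imat_mult a ((Lam \<delta> ^^ j) b) \<noteq> imat_zero}"
    and "finite {j. imat_mult ((Lam \<delta> ^^ j) b) a \<noteq> imat_zero}"
proof -
  obtain N where N: "\<And>i j. i \<ge> N \<or> j \<ge> N \<Longrightarrow> a i j = 0"
    using Mat_bounded[OF assms] by blast
  have l: "a m k * (Lam \<delta> ^^ j) b k n = 0" and r: "(Lam \<delta> ^^ j) b m k * a k n = 0"
    if "j \<ge> N" for j m k n
    using N[of m k] N[of k n] Lam_pow_eq_0[of k j n b] Lam_pow_eq_0[of m j k b] that
    by (cases "k \<ge> N"; simp)+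
  have "{j. imat_mult a ((Lam \<delta> ^^ j) b) \<noteq> imat_zero} \<subseteq> {..<N}"
    using l by (fastforce simp: imat_mult_def imat_zero_def not_less)
  then show "finite {j. imat_mult a ((Lam \<delta> ^^ j) b) \<noteq> imat_zero}"
    using finite_subset by blast
  have "{j. imat_mult ((Lam \<delta> ^^ j) b) a \<noteq> imat_zero} \<subseteq> {..<N}"
    using r by (fastforce simp: imat_mult_def imat_zero_def not_less)
  then show "finite {j. imat_mult ((Lam \<delta> ^^ j) b) a \<noteq> imat_zero}"
    using finite_subset by blast
qed

text \<open>
  The two readings of \<open>a \<cdot> \<Sum>\<^sub>j \<Lambda>\<^sup>j(b)\<close> agree.
\<close>

lemma imat_mult_sum_Lam_pow:
  assumes "a \<in> Mat \<delta>"
  shows "imat_mult a (\<lambda>m n. Sum_any (\<lambda>j. (Lam \<delta> ^^ j) b m n)) =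
         (\<lambda>m n. Sum_any (\<lambda>j. imat_mult a ((Lam \<delta> ^^ j) b) m n))"
proof (intro ext)
  fix m n
  obtain N where N: "\<And>i j. i \<ge> N \<or> j \<ge> N \<Longrightarrow> a i j = 0"
    using Mat_bounded[OF assms] by blast
  have inner: "Sum_any (\<lambda>j. (Lam \<delta> ^^ j) b k n) = (\<Sum>j\<le>n. (Lam \<delta> ^^ j) b k n)" for k
    using Lam_pow_eq_0[of k _ n b]
    by (intro Sum_any.expand_superset) (auto simp: not_less[symmetric])
  have prod: "Sum_any (\<lambda>k. a m k * c k) = (\<Sum>k<N. a m k * c k)" for c
  proof (intro Sum_any.expand_superset)
    show "{k. a m k * c k \<noteq> 0} \<subseteq> {..<N}"
      using N[of m] by (metis (mono_tags, lifting) lessThan_iff mem_Collect_eq mult_zero_left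
        not_less subsetI)
  qed simp
  have outer: "Sum_any (\<lambda>j. \<Sum>k<N. a m k * (Lam \<delta> ^^ j) b k n) =
        (\<Sum>j\<le>n. \<Sum>k<N. a m k * (Lam \<delta> ^^ j) b k n)"
  proof (intro Sum_any.expand_superset)
    show "{j. (\<Sum>k<N. a m k * (Lam \<delta> ^^ j) b k n) \<noteq> 0} \<subseteq> {..n}"
    proof (rule subsetI, rule ccontr)
      fix j assume "j \<in> {j. (\<Sum>k<N. a m k * (Lam \<delta> ^^ j) b k n) \<noteq> 0}" and "j \<notin> {..n}"
      then show False by (simp add: Lam_pow_eq_0)
    qed
  qed simp
  show "imat_mult a (\<lambda>m n. Sum_any (\<lambda>j. (Lam \<delta> ^^ j) b m n)) m n =
        Sum_any (\<lambda>j. imat_mult a ((Lam \<delta> ^^ j) b) m n)"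
    by (simp add: imat_mult_def inner prod outer sum_distrib_left sum.swap[of _ "{..n}"])
qed

end

end

theory Submission
  imports Defs
begin

text \<open>
  Associativity and compatibility with the involution become transparent after the substitution
  \<open>a \<mapsto> S a = \<Sum>\<^sub>j \<Lambda>\<^sup>j(a)\<close>.  The matrix \<open>S a\<close> has infinitely many non-zero entries in general, but
  each of its rows is finite, so \<open>S\<close> takes values in the row-finite matrices, where the usual
  matrix product is defined and associative.

  The matrix \<open>S a\<close> is the only solution \<open>X\<close> of \<open>X = a + \<Lambda>(X)\<close> (\<open>Lam_sum_unfold\<close>,
  \<open>Lam_sum_unique\<close>).  In particular \<open>a\<close> can be recovered from \<open>S a\<close>, so \<open>S\<close> is injective.  As
  \<open>\<Lambda>\<close> is linear, multiplicative and commutes with the involution,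
  uniqueness shows that \<open>S\<close> is linear and commutes with the involution.  It also shows that
  \<open>S (a \<star> b) = S a \<cdot> S b\<close>: since \<open>\<Lambda>(S a) = S a - a\<close>,
  \<open>S a \<cdot> S b - \<Lambda>(S a \<cdot> S b) = S a \<cdot> S b - (S a - a) \<cdot> (S b - b) = a \<cdot> S b + (S a - a) \<cdot> b\<close>,
  and the right-hand side is \<open>a \<star> b\<close> (\<open>imat_star_conv_Lam_sum\<close>, \<open>Lam_sum_star\<close>).  Hence \<open>S\<close> embeds
  \<open>\<M>(\<A>)\<close> with the product \<open>\<star>\<close> into the algebra of row-finite matrices, and all identities
  are inherited from there.  It remains to see that \<open>\<star>\<close> preserves \<open>\<M>(\<A>)\<close>, which holds
  because a matrix with finitely many non-zero entries times a row-finite one has again finitely many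
  non-zero entries, and dually for a column-finite matrix times one with finitely many non-zero
  entries; the conditions on the entries pass to \<open>\<Lambda>(a)\<close> because \<open>\<delta>(\<delta>\<^sup>i(1)) = \<delta>\<^sup>i\<^sup>+\<^sup>1(1)\<close>.
\<close>

section \<open>Linearity of the matrix operations\<close>

lemma scaleC_zero: "c *\<^sub>C 0 = (0 :: 'a::unital_cstar_algebra)"
  using scaleC_add_right[of c "0::'a" 0] by simp

lemma scaleC_sum: "c *\<^sub>C sum f F = (\<Sum>k\<in>F. c *\<^sub>C (f k :: 'a::unital_cstar_algebra))"
  by (induction F rule: infinite_finite_induct) (simp_all add: scaleC_zero scaleC_add_right)

lemma adj_zero: "adj 0 = (0 :: 'a::unital_cstar_algebra)"
  using adj_add[of "0::'a" 0] by simp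

lemma adj_sum: "adj (sum f F) = (\<Sum>k\<in>F. adj (f k :: 'a::unital_cstar_algebra))"
  by (induction F rule: infinite_finite_induct) (simp_all add: adj_zero adj_add)

lemma adj_one: "adj 1 = (1 :: 'a::unital_cstar_algebra)"
  using adj_mult[of "adj (1::'a)" 1] by (simp add: adj_adj)

lemma imat_adj_adj: "imat_adj (imat_adj a) = a"
  by (simp add: imat_adj_def adj_adj)

lemma imat_adj_add: "imat_adj (imat_add a b) = imat_add (imat_adj a) (imat_adj b)"
  by (simp add: imat_adj_def imat_add_def adj_add)

lemma imat_adj_scale: "imat_adj (imat_scale s a) = imat_scale (cnj s) (imat_adj a)"
  by (simp add: imat_adj_def imat_scale_def adj_scaleC)

lemma imat_scale_add: "imat_scale s (imat_add a b) = imat_add (imat_scale s a) (imat_scale s b)"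
  by (simp add: imat_scale_def imat_add_def scaleC_add_right)


section \<open>Row-finite matrices\<close>

definition row_finite :: "'a::unital_cstar_algebra imat \<Rightarrow> bool" where
  "row_finite a \<longleftrightarrow> (\<forall>m. finite {k. a m k \<noteq> 0})"

lemma imat_mult_eq_sum:
  assumes "finite F" and "{k. a m k \<noteq> 0} \<subseteq> F"
  shows "imat_mult a b m n = (\<Sum>k\<in>F. a m k * b k n)"
  unfolding imat_mult_def using assms by (intro Sum_any.expand_superset) auto

lemma imat_mult_row_finite:
  assumes "row_finite a"
  shows "imat_mult a b m n = (\<Sum>k | a m k \<noteq> 0. a m k * b k n)"
  using assms by (intro imat_mult_eq_sum) (simp_all add: row_finite_def)

lemma imat_mult_add_left:
  assumes "row_finite a" "row_finite b"
  shows "imat_mult (imat_add a b) c = imat_add (imat_mult a c) (imat_mult b c)"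
proof (intro ext)
  fix m n
  define F where "F = {k. a m k \<noteq> 0} \<union> {k. b m k \<noteq> 0}"
  have fin: "finite F" using assms by (simp add: F_def row_finite_def)
  have sub: "{k. imat_add a b m k \<noteq> 0} \<subseteq> F" "{k. a m k \<noteq> 0} \<subseteq> F" "{k. b m k \<noteq> 0} \<subseteq> F"
    by (auto simp: F_def imat_add_def)
  have "imat_mult (imat_add a b) c m n = (\<Sum>k\<in>F. imat_add a b m k * c k n)"
    using fin sub(1) by (rule imat_mult_eq_sum)
  also have "\<dots> = (\<Sum>k\<in>F. a m k * c k n) + (\<Sum>k\<in>F. b m k * c k n)"
    by (simp only: imat_add_def distrib_right sum.distrib)
  also have "(\<Sum>k\<in>F. a m k * c k n) = imat_mult a c m n"
    using fin sub(2) by (rule imat_mult_eq_sum[symmetric])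
  also have "(\<Sum>k\<in>F. b m k * c k n) = imat_mult b c m n"
    using fin sub(3) by (rule imat_mult_eq_sum[symmetric])
  finally show "imat_mult (imat_add a b) c m n = imat_add (imat_mult a c) (imat_mult b c) m n"
    by (simp only: imat_add_def)
qed

lemma imat_mult_add_right:
  assumes "row_finite a"
  shows "imat_mult a (imat_add b c) = imat_add (imat_mult a b) (imat_mult a c)"
proof (intro ext)
  fix m n
  show "imat_mult a (imat_add b c) m n = imat_add (imat_mult a b) (imat_mult a c) m n"
    unfolding imat_add_def imat_mult_row_finite[OF assms] by (simp only: distrib_left sum.distrib)
qed

lemma imat_mult_scale_left:
  assumes "row_finite a"
  shows "imat_mult (imat_scale s a) b = imat_scale s (imat_mult a b)"
proof (intro ext)
  fix m n
  define F where "F = {k. a m k \<noteq> 0}"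
  have F: "finite F" "{k. a m k \<noteq> 0} = F"
      "\<And>b n. imat_mult a b m n = (\<Sum>k\<in>F. a m k * b k n)"
    using assms by (simp_all add: F_def row_finite_def imat_mult_row_finite)
  have "{k. imat_scale s a m k \<noteq> 0} \<subseteq> F"
    using F(2) by (auto simp: imat_scale_def scaleC_zero)
  then have "imat_mult (imat_scale s a) b m n = (\<Sum>k\<in>F. imat_scale s a m k * b k n)"
    by (rule imat_mult_eq_sum[OF F(1)])
  also have "\<dots> = imat_scale s (imat_mult a b) m n"
    unfolding imat_scale_def F(3) by (simp only: mult_scaleC_left scaleC_sum)
  finally show "imat_mult (imat_scale s a) b m n = imat_scale s (imat_mult a b) m n" .
qed

lemma imat_mult_scale_right:
  assumes "row_finite a"
  shows "imat_mult a (imat_scale s b) = imat_scale s (imat_mult a b)"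
proof (intro ext)
  fix m n
  show "imat_mult a (imat_scale s b) m n = imat_scale s (imat_mult a b) m n"
    unfolding imat_scale_def imat_mult_row_finite[OF assms] by (simp only: mult_scaleC_right scaleC_sum)
qed

lemma imat_mult_assoc:
  assumes "row_finite a" "row_finite b"
  shows "imat_mult (imat_mult a b) c = imat_mult a (imat_mult b c)"
proof (intro ext)
  fix m n
  define F where "F = {k. a m k \<noteq> 0}"
  have F: "finite F" "\<And>b n. imat_mult a b m n = (\<Sum>k\<in>F. a m k * b k n)"
    using assms(1) by (simp_all add: F_def row_finite_def imat_mult_row_finite)
  define G where "G = (\<Union>k\<in>F. {l. b k l \<noteq> 0})"
  have finG: "finite G" using F(1) assms(2) by (simp add: G_def row_finite_def)
  have bc: "imat_mult b c k n = (\<Sum>l\<in>G. b k l * c l n)" if "k \<in> F" for k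
    by (rule imat_mult_eq_sum[OF finG]) (use that in \<open>auto simp: G_def\<close>)
  have "{l. imat_mult a b m l \<noteq> 0} \<subseteq> G"
    unfolding F(2) G_def by (auto elim!: sum.not_neutral_contains_not_neutral)
  then have "imat_mult (imat_mult a b) c m n = (\<Sum>l\<in>G. \<Sum>k\<in>F. a m k * b k l * c l n)"
    by (simp add: imat_mult_eq_sum[OF finG] F(2) sum_distrib_right)
  also have "\<dots> = (\<Sum>k\<in>F. \<Sum>l\<in>G. a m k * b k l * c l n)"
    by (rule sum.swap)
  also have "\<dots> = imat_mult a (imat_mult b c) m n"
    by (simp add: F(2) bc sum_distrib_left mult.assoc)
  finally show "imat_mult (imat_mult a b) c m n = imat_mult a (imat_mult b c) m n" .
qed

text \<open>
  The matrix \<open>b\<^sup>*\<close> need not be row-finite, but the entry of \<open>b\<^sup>* \<cdot> a\<^sup>*\<close> at \<open>(m, n)\<close> is still a finite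
  sum, because its terms vanish wherever row \<open>n\<close> of \<open>a\<close> does.
\<close>

lemma imat_adj_mult:
  assumes "row_finite a"
  shows "imat_adj (imat_mult a b) = imat_mult (imat_adj b) (imat_adj a)"
proof (intro ext)
  fix m n
  define F where "F = {k. a n k \<noteq> 0}"
  have F: "finite F" "{k. a n k \<noteq> 0} = F"
      "\<And>b m. imat_mult a b n m = (\<Sum>k\<in>F. a n k * b k m)"
    using assms by (simp_all add: F_def row_finite_def imat_mult_row_finite)
  have "imat_mult (imat_adj b) (imat_adj a) m n = (\<Sum>k\<in>F. adj (b k m) * adj (a n k))"
    unfolding imat_mult_def imat_adj_def
    using F(1,2) by (intro Sum_any.expand_superset) (auto simp: adj_zero)
  then show "imat_adj (imat_mult a b) m n = imat_mult (imat_adj b) (imat_adj a) m n"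
    by (simp add: imat_adj_def F(3) adj_sum adj_mult)
qed

lemma finite_entries_imp_row_finite:
  assumes "finite {(i, j). a i j \<noteq> 0}"
  shows "row_finite a"
  unfolding row_finite_def
proof
  fix m
  have "{k. a m k \<noteq> 0} \<subseteq> snd ` {(i, j). a i j \<noteq> 0}" by force
  then show "finite {k. a m k \<noteq> 0}" using assms finite_subset by blast
qed

lemma finite_entries_add:
  assumes "finite {(i, j). a i j \<noteq> 0}" "finite {(i, j). b i j \<noteq> 0}"
  shows "finite {(i, j). imat_add a b i j \<noteq> 0}"
  by (rule finite_subset[OF _ finite_UnI[OF assms]]) (auto simp: imat_add_def)

lemma finite_entries_scale:
  assumes "finite {(i, j). a i j \<noteq> 0}"
  shows "finite {(i, j). imat_scale s a i j \<noteq> 0}"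
  by (rule finite_subset[OF _ assms]) (auto simp: imat_scale_def scaleC_zero)

lemma finite_entries_adj:
  assumes "finite {(i, j). a i j \<noteq> 0}"
  shows "finite {(i, j). imat_adj a i j \<noteq> 0}"
proof -
  have "{(i, j). imat_adj a i j \<noteq> 0} \<subseteq> prod.swap ` {(i, j). a i j \<noteq> 0}"
    by (force simp: imat_adj_def adj_zero)
  then show ?thesis using assms finite_subset by blast
qed

text \<open>
  Each non-zero entry of \<open>a\<close>, in column \<open>k\<close> say, affects only the finitely many columns that meet the
  support of row \<open>k\<close> of \<open>b\<close>.
\<close>

lemma finite_entries_mult:
  assumes "finite {(i, j). a i j \<noteq> 0}" "row_finite b"
  shows "finite {(i, j). imat_mult a b i j \<noteq> 0}"
proof -
  have "{(i, j). imat_mult a b i j \<noteq> 0} \<subseteq>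
          (\<Union>(m, k)\<in>{(i, j). a i j \<noteq> 0}. {m} \<times> {n. b k n \<noteq> 0})"
  proof clarify
    fix m n assume "imat_mult a b m n \<noteq> 0"
    then obtain k where "a m k * b k n \<noteq> 0"
      unfolding imat_mult_def using Sum_any.not_neutral_obtains_not_neutral by blast
    then show "(m, n) \<in> (\<Union>(m, k)\<in>{(i, j). a i j \<noteq> 0}. {m} \<times> {n. b k n \<noteq> 0})"
      by (intro UN_I[of "(m, k)"]) auto
  qed
  moreover have "finite (\<Union>(m, k)\<in>{(i, j). a i j \<noteq> 0}. {m} \<times> {n. b k n \<noteq> 0})"
    using assms by (auto simp: row_finite_def)
  ultimately show ?thesis by (rule finite_subset)
qed


section \<open>The endomorphism \<open>\<Lambda>\<close> on row-finite matrices\<close>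

text \<open>
  This is the map \<open>S\<close> of the introduction, with the sum taken entrywise.
\<close>

definition Lam_sum :: "('a::unital_cstar_algebra \<Rightarrow> 'a) \<Rightarrow> 'a imat \<Rightarrow> 'a imat" where
  "Lam_sum \<delta> a = (\<lambda>m n. Sum_any (\<lambda>j. (Lam \<delta> ^^ j) a m n))"

text \<open>
  Since \<open>\<delta>\<^sup>i(1)\<close> is idempotent, membership of an entry in \<open>\<delta>\<^sup>i(1)\<A>\<delta>\<^sup>j(1)\<close> can be tested by
  multiplication on either side, which is a condition closed under sums.
\<close>

definition corner_entries :: "('a::unital_cstar_algebra \<Rightarrow> 'a) \<Rightarrow> 'a imat \<Rightarrow> bool" where
  "corner_entries \<delta> a \<longleftrightarrow>
     (\<forall>i j. (\<delta> ^^ i) 1 * a i j = a i j \<and> a i j * (\<delta> ^^ j) 1 = a i j)"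

lemma Lam_simps [simp]:
  "Lam \<delta> a 0 n = 0" "Lam \<delta> a m 0 = 0" "Lam \<delta> a (Suc m) (Suc n) = \<delta> (a m n)"
  by (simp_all add: Lam_def)

lemma imat_eq_by_border:
  assumes "\<And>n. a 0 n = b 0 n" "\<And>m. a (Suc m) 0 = b (Suc m) 0"
    "\<And>m n. a (Suc m) (Suc n) = b (Suc m) (Suc n)"
  shows "a = (b :: 'a imat)"
proof (intro ext)
  show "a m n = b m n" for m n
    using assms by (cases m; cases n) simp_all
qed

context cstar_dynamical_system
begin

lemma \<delta>_sum: "\<delta> (sum f F) = (\<Sum>k\<in>F. \<delta> (f k))"
  by (induction F rule: infinite_finite_induct) (simp_all add: \<delta>_zero \<delta>_add)

lemma Lam_add: "Lam \<delta> (imat_add a b) = imat_add (Lam \<delta> a) (Lam \<delta> b)"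
  by (rule imat_eq_by_border) (simp_all add: imat_add_def \<delta>_add)

lemma Lam_scale: "Lam \<delta> (imat_scale s a) = imat_scale s (Lam \<delta> a)"
  by (rule imat_eq_by_border) (simp_all add: imat_scale_def \<delta>_scaleC scaleC_zero)

lemma Lam_adj: "Lam \<delta> (imat_adj a) = imat_adj (Lam \<delta> a)"
  by (rule imat_eq_by_border) (simp_all add: imat_adj_def \<delta>_adj adj_zero)

lemma row_finite_Lam:
  assumes "row_finite a"
  shows "row_finite (Lam \<delta> a)"
  unfolding row_finite_def
proof
  fix m
  have "{k. Lam \<delta> a m k \<noteq> 0} \<subseteq> Suc ` {k. a (m - 1) k \<noteq> 0}"
  proof
    fix k assume "k \<in> {k. Lam \<delta> a m k \<noteq> 0}"
    then show "k \<in> Suc ` {k. a (m - 1) k \<noteq> 0}"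
      by (cases m; cases k) (auto simp: \<delta>_zero)
  qed
  then show "finite {k. Lam \<delta> a m k \<noteq> 0}"
    by (rule finite_subset) (use assms in \<open>simp add: row_finite_def\<close>)
qed

lemma row_finite_Lam_pow: "row_finite a \<Longrightarrow> row_finite ((Lam \<delta> ^^ j) a)"
  by (induction j) (simp_all add: row_finite_Lam)

text \<open>
  An entry of the product on the right sums over all indices \<open>k\<close>, and the entry of \<open>a \<cdot> b\<close> to which
  \<open>\<delta>\<close> is applied gives the terms with \<open>k \<ge> 1\<close>; the term with \<open>k = 0\<close> vanishes.
\<close>

lemma Lam_mult:
  assumes "row_finite a"
  shows "Lam \<delta> (imat_mult a b) = imat_mult (Lam \<delta> a) (Lam \<delta> b)"
proof (rule imat_eq_by_border)
  fix m n
  define F where "F = {k. a m k \<noteq> 0}"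
  have F: "finite F" "{k. a m k \<noteq> 0} = F"
      "\<And>b n. imat_mult a b m n = (\<Sum>k\<in>F. a m k * b k n)"
    using assms by (simp_all add: F_def row_finite_def imat_mult_row_finite)
  have sub: "{k. Lam \<delta> a (Suc m) k \<noteq> 0} \<subseteq> Suc ` F"
  proof
    fix k assume "k \<in> {k. Lam \<delta> a (Suc m) k \<noteq> 0}"
    then show "k \<in> Suc ` F" using F(2) by (cases k) (auto simp: \<delta>_zero)
  qed
  have "imat_mult (Lam \<delta> a) (Lam \<delta> b) (Suc m) (Suc n) =
          (\<Sum>k\<in>Suc ` F. Lam \<delta> a (Suc m) k * Lam \<delta> b k (Suc n))"
    using F(1) sub by (intro imat_mult_eq_sum) simp_all
  also have "\<dots> = (\<Sum>k\<in>F. \<delta> (a m k) * \<delta> (b k n))"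
    by (simp add: sum.reindex)
  finally show "Lam \<delta> (imat_mult a b) (Suc m) (Suc n) =
      imat_mult (Lam \<delta> a) (Lam \<delta> b) (Suc m) (Suc n)"
    by (simp add: F(3) \<delta>_sum \<delta>_mult)
qed (simp_all add: imat_mult_def)


section \<open>The embedding \<open>S\<close>\<close>

text \<open>
  The first \<open>j\<close> rows of \<open>\<Lambda>\<^sup>j(a)\<close> vanish.  Hence one bound on \<open>j\<close> serves a whole row of \<open>S a\<close>,
  which gives row-finiteness and lets sums over \<open>j\<close> be exchanged with matrix products.
\<close>

lemma Lam_sum_eq_sum: "Lam_sum \<delta> a m n = (\<Sum>j\<le>m. (Lam \<delta> ^^ j) a m n)"
  unfolding Lam_sum_def using Lam_pow_eq_0[of m _ n a]
  by (intro Sum_any.expand_superset) (auto simp: not_less[symmetric])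

lemma Lam_Lam_sum_eq_sum: "Lam \<delta> (Lam_sum \<delta> a) m n = (\<Sum>j\<in>{1..m}. (Lam \<delta> ^^ j) a m n)"
proof (cases m)
  case m: (Suc m')
  show ?thesis
  proof (cases n)
    case (Suc n')
    have "Lam \<delta> (Lam_sum \<delta> a) m n = (\<Sum>j\<le>m'. (Lam \<delta> ^^ Suc j) a m n)"
      using m Suc by (simp add: Lam_sum_eq_sum \<delta>_sum)
    also have "\<dots> = (\<Sum>j\<in>{1..m}. (Lam \<delta> ^^ j) a m n)"
      by (simp only: m One_nat_def sum.atLeast1_atMost_eq lessThan_Suc_atMost)
    finally show ?thesis .
  qed (simp add: Lam_pow_eq_0)
qed simp

lemma Lam_sum_unfold: "Lam_sum \<delta> a = imat_add a (Lam \<delta> (Lam_sum \<delta> a))"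
proof (intro ext)
  fix m n :: nat
  have "{..m} = insert 0 {1..m}" by auto
  then show "Lam_sum \<delta> a m n = imat_add a (Lam \<delta> (Lam_sum \<delta> a)) m n"
    unfolding imat_add_def Lam_Lam_sum_eq_sum Lam_sum_eq_sum by simp
qed

text \<open>
  The equation determines the border of \<open>X\<close>, and each further entry from its upper left neighbour.
\<close>

lemma Lam_sum_unique:
  assumes X: "X = imat_add a (Lam \<delta> X)"
  shows "X = Lam_sum \<delta> a"
proof (intro ext)
  fix m n
  show "X m n = Lam_sum \<delta> a m n"
  proof (induction m arbitrary: n)
    case 0
    show ?case
      by (subst X, subst Lam_sum_unfold) (simp add: imat_add_def)
  next
    case (Suc m)
    then show ?case
      by (subst X, subst Lam_sum_unfold, cases n) (simp_all add: imat_add_def)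
  qed
qed

lemma Lam_sum_inject:
  assumes "Lam_sum \<delta> a = Lam_sum \<delta> b"
  shows "a = b"
proof (intro ext)
  fix m n
  have "a m n = Lam_sum \<delta> a m n - Lam \<delta> (Lam_sum \<delta> a) m n" for a
    using fun_cong[OF fun_cong[OF Lam_sum_unfold[of a]], of m n]
    by (simp only: imat_add_def add_diff_cancel_right')
  then show "a m n = b m n"
    using assms by metis
qed

lemma Lam_sum_add: "Lam_sum \<delta> (imat_add a b) = imat_add (Lam_sum \<delta> a) (Lam_sum \<delta> b)"
proof (rule Lam_sum_unique[symmetric])
  show "imat_add (Lam_sum \<delta> a) (Lam_sum \<delta> b) =
      imat_add (imat_add a b) (Lam \<delta> (imat_add (Lam_sum \<delta> a) (Lam_sum \<delta> b)))"
    by (subst (1) Lam_sum_unfold[of a], subst (1) Lam_sum_unfold[of b], simp only: Lam_add)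
      (simp add: imat_add_def add_ac)
qed

lemma Lam_sum_scale: "Lam_sum \<delta> (imat_scale s a) = imat_scale s (Lam_sum \<delta> a)"
  by (rule Lam_sum_unique[symmetric])
    (simp only: Lam_scale imat_scale_add[symmetric] Lam_sum_unfold[symmetric])

lemma Lam_sum_adj: "Lam_sum \<delta> (imat_adj a) = imat_adj (Lam_sum \<delta> a)"
  by (rule Lam_sum_unique[symmetric])
    (simp only: Lam_adj imat_adj_add[symmetric] Lam_sum_unfold[symmetric])

lemma row_finite_Lam_sum:
  assumes "row_finite a"
  shows "row_finite (Lam_sum \<delta> a)"
  unfolding row_finite_def
proof
  fix m
  have "{n. Lam_sum \<delta> a m n \<noteq> 0} \<subseteq> (\<Union>j\<le>m. {n. (Lam \<delta> ^^ j) a m n \<noteq> 0})"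
    unfolding Lam_sum_eq_sum by (auto elim!: sum.not_neutral_contains_not_neutral)
  then show "finite {n. Lam_sum \<delta> a m n \<noteq> 0}"
    by (rule finite_subset) (use row_finite_Lam_pow[OF assms] in \<open>simp add: row_finite_def\<close>)
qed

text \<open>
  In row \<open>m\<close> only the terms with \<open>j \<le> m\<close> contribute, and these have finite rows, so the sum over \<open>j \<ge> 1\<close>
  of the products \<open>\<Lambda>\<^sup>j(a) \<cdot> b\<close> is the product of the sum, \<open>\<Lambda>(S a) \<cdot> b\<close>.
\<close>

lemma imat_star_conv_Lam_sum:
  assumes "row_finite a"
  shows "imat_star \<delta> a b =
    imat_add (imat_mult a (Lam_sum \<delta> b)) (imat_mult (Lam \<delta> (Lam_sum \<delta> a)) b)"
proof -
  have "Sum_any (\<lambda>j. if 1 \<le> j then imat_mult ((Lam \<delta> ^^ j) a) b m n else 0) =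
        imat_mult (Lam \<delta> (Lam_sum \<delta> a)) b m n" for m n
  proof -
    define F where "F = (\<Union>j\<le>m. {k. (Lam \<delta> ^^ j) a m k \<noteq> 0})"
    have fin: "finite F"
      using row_finite_Lam_pow[OF assms] by (simp add: F_def row_finite_def)
    have pow: "imat_mult ((Lam \<delta> ^^ j) a) b m n = (\<Sum>k\<in>F. (Lam \<delta> ^^ j) a m k * b k n)"
      if "j \<le> m" for j
      by (rule imat_mult_eq_sum[OF fin]) (use that in \<open>auto simp: F_def\<close>)
    have "{k. Lam \<delta> (Lam_sum \<delta> a) m k \<noteq> 0} \<subseteq> F"
      unfolding Lam_Lam_sum_eq_sum F_def
      by (auto elim!: sum.not_neutral_contains_not_neutral)
    then have "imat_mult (Lam \<delta> (Lam_sum \<delta> a)) b m n =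
        (\<Sum>k\<in>F. \<Sum>j\<in>{1..m}. (Lam \<delta> ^^ j) a m k * b k n)"
      by (simp only: imat_mult_eq_sum[OF fin] Lam_Lam_sum_eq_sum sum_distrib_right)
    also have "\<dots> = (\<Sum>j\<in>{1..m}. imat_mult ((Lam \<delta> ^^ j) a) b m n)"
      by (subst sum.swap) (simp add: pow)
    also have "\<dots> =
        (\<Sum>j\<in>{1..m}. if 1 \<le> j then imat_mult ((Lam \<delta> ^^ j) a) b m n else 0)"
      by (rule sum.cong) simp_all
    also have "\<dots> = Sum_any (\<lambda>j. if 1 \<le> j then imat_mult ((Lam \<delta> ^^ j) a) b m n else 0)"
    proof (rule Sum_any.expand_superset[symmetric])
      have "imat_mult ((Lam \<delta> ^^ j) a) b m n = 0" if "m < j" for j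
        using that by (simp add: imat_mult_def Lam_pow_eq_0)
      then show "{j. (if 1 \<le> j then imat_mult ((Lam \<delta> ^^ j) a) b m n else 0) \<noteq> 0} \<subseteq> {1..m}"
        by (auto split: if_splits simp: not_less[symmetric])
    qed simp
    finally show ?thesis ..
  qed
  then show ?thesis by (simp add: imat_star_def Lam_sum_def)
qed

text \<open>
  With \<open>X = S a\<close> and \<open>Y = S b\<close>, expanding \<open>X = a + \<Lambda>(X)\<close> in the left factor and then
  \<open>Y = b + \<Lambda>(Y)\<close> in the second summand gives
  \<open>X \<cdot> Y = a \<cdot> Y + \<Lambda>(X) \<cdot> b + \<Lambda>(X) \<cdot> \<Lambda>(Y)\<close>, so \<open>X \<cdot> Y\<close> satisfies the equation that
  characterizes \<open>S (a \<star> b)\<close>.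
\<close>

lemma Lam_sum_star:
  assumes "row_finite a"
  shows "Lam_sum \<delta> (imat_star \<delta> a b) = imat_mult (Lam_sum \<delta> a) (Lam_sum \<delta> b)"
proof (rule Lam_sum_unique[symmetric])
  let ?X = "Lam_sum \<delta> a" and ?Y = "Lam_sum \<delta> b"
  have rf: "row_finite ?X" "row_finite (Lam \<delta> ?X)"
    using assms by (simp_all add: row_finite_Lam_sum row_finite_Lam)
  have "imat_mult ?X ?Y = imat_mult (imat_add a (Lam \<delta> ?X)) ?Y"
    by (simp only: Lam_sum_unfold[symmetric])
  also have "\<dots> = imat_add (imat_mult a ?Y) (imat_mult (Lam \<delta> ?X) (imat_add b (Lam \<delta> ?Y)))"
    by (subst imat_mult_add_left[OF assms rf(2)]) (simp only: Lam_sum_unfold[symmetric])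
  also have "\<dots> = imat_add (imat_star \<delta> a b) (imat_mult (Lam \<delta> ?X) (Lam \<delta> ?Y))"
    unfolding imat_mult_add_right[OF rf(2)] imat_star_conv_Lam_sum[OF assms]
    by (simp add: imat_add_def add_ac)
  finally show "imat_mult ?X ?Y = imat_add (imat_star \<delta> a b) (Lam \<delta> (imat_mult ?X ?Y))"
    unfolding Lam_mult[OF rf(1)] .
qed


section \<open>Closure of \<open>\<M>(\<A>)\<close>\<close>

lemma \<delta>_pow_one_idem: "(\<delta> ^^ i) 1 * (\<delta> ^^ i) 1 = (\<delta> ^^ i) 1"
  by (induction i) (simp_all add: \<delta>_mult[symmetric])

lemma adj_\<delta>_pow_one: "adj ((\<delta> ^^ i) 1) = (\<delta> ^^ i) 1"
  by (induction i) (simp_all add: adj_one \<delta>_adj[symmetric])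

lemma mem_Mat_iff: "a \<in> Mat \<delta> \<longleftrightarrow> corner_entries \<delta> a \<and> finite {(i, j). a i j \<noteq> 0}"
proof -
  have "(\<exists>x. y = (\<delta> ^^ i) 1 * x * (\<delta> ^^ j) 1) \<longleftrightarrow>
      (\<delta> ^^ i) 1 * y = y \<and> y * (\<delta> ^^ j) 1 = y" for y i j
  proof
    assume "\<exists>x. y = (\<delta> ^^ i) 1 * x * (\<delta> ^^ j) 1"
    then obtain x where y: "y = (\<delta> ^^ i) 1 * x * (\<delta> ^^ j) 1" ..
    have "(\<delta> ^^ i) 1 * y = ((\<delta> ^^ i) 1 * (\<delta> ^^ i) 1) * x * (\<delta> ^^ j) 1"
      by (simp only: y mult.assoc)
    moreover have "y * (\<delta> ^^ j) 1 = (\<delta> ^^ i) 1 * x * ((\<delta> ^^ j) 1 * (\<delta> ^^ j) 1)"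
      by (simp only: y mult.assoc)
    ultimately show "(\<delta> ^^ i) 1 * y = y \<and> y * (\<delta> ^^ j) 1 = y"
      by (simp only: \<delta>_pow_one_idem y)
  next
    assume "(\<delta> ^^ i) 1 * y = y \<and> y * (\<delta> ^^ j) 1 = y"
    then have "y = (\<delta> ^^ i) 1 * y * (\<delta> ^^ j) 1" by simp
    then show "\<exists>x. y = (\<delta> ^^ i) 1 * x * (\<delta> ^^ j) 1" ..
  qed
  then show ?thesis by (auto simp: Mat_def corner_entries_def)
qed

lemma Mat_row_finite: "a \<in> Mat \<delta> \<Longrightarrow> row_finite a"
  by (simp add: mem_Mat_iff finite_entries_imp_row_finite)

lemma corner_entries_add:
  "corner_entries \<delta> a \<Longrightarrow> corner_entries \<delta> b \<Longrightarrow> corner_entries \<delta> (imat_add a b)"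
  by (simp add: corner_entries_def imat_add_def algebra_simps)

lemma corner_entries_scale: "corner_entries \<delta> a \<Longrightarrow> corner_entries \<delta> (imat_scale s a)"
  by (simp add: corner_entries_def imat_scale_def mult_scaleC_left mult_scaleC_right)

lemma corner_entries_adj: "corner_entries \<delta> a \<Longrightarrow> corner_entries \<delta> (imat_adj a)"
  unfolding corner_entries_def imat_adj_def
proof (intro allI)
  fix i j
  assume "\<forall>i j. (\<delta> ^^ i) 1 * a i j = a i j \<and> a i j * (\<delta> ^^ j) 1 = a i j"
  then have "adj (a j i * (\<delta> ^^ i) 1) = adj (a j i)" "adj ((\<delta> ^^ j) 1 * a j i) = adj (a j i)"
    by simp_all
  then show "(\<delta> ^^ i) 1 * adj (a j i) = adj (a j i) \<and> adj (a j i) * (\<delta> ^^ j) 1 = adj (a j i)"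
    by (simp add: adj_mult adj_\<delta>_pow_one)
qed

lemma corner_entries_Lam:
  assumes "corner_entries \<delta> a"
  shows "corner_entries \<delta> (Lam \<delta> a)"
  unfolding corner_entries_def
proof (intro allI)
  fix i j
  show "(\<delta> ^^ i) 1 * Lam \<delta> a i j = Lam \<delta> a i j \<and> Lam \<delta> a i j * (\<delta> ^^ j) 1 = Lam \<delta> a i j"
    using assms by (cases i; cases j) (simp_all add: corner_entries_def \<delta>_mult[symmetric])
qed

lemma corner_entries_Lam_pow: "corner_entries \<delta> a \<Longrightarrow> corner_entries \<delta> ((Lam \<delta> ^^ j) a)"
  by (induction j) (simp_all add: corner_entries_Lam)

lemma corner_entries_Lam_sum:
  assumes "corner_entries \<delta> a"
  shows "corner_entries \<delta> (Lam_sum \<delta> a)"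
  using corner_entries_Lam_pow[OF assms]
  by (simp add: corner_entries_def Lam_sum_eq_sum sum_distrib_left sum_distrib_right)

lemma corner_entries_mult:
  assumes "row_finite a" "corner_entries \<delta> a" "corner_entries \<delta> b"
  shows "corner_entries \<delta> (imat_mult a b)"
  unfolding corner_entries_def
proof (intro allI)
  fix i j
  have "(\<delta> ^^ i) 1 * (a i k * b k j) = a i k * b k j" for k
    using assms(2) by (simp add: corner_entries_def mult.assoc[symmetric])
  moreover have "a i k * b k j * (\<delta> ^^ j) 1 = a i k * b k j" for k
    using assms(3) by (simp add: corner_entries_def mult.assoc)
  ultimately show "(\<delta> ^^ i) 1 * imat_mult a b i j = imat_mult a b i j \<and>
      imat_mult a b i j * (\<delta> ^^ j) 1 = imat_mult a b i j"
    by (simp add: imat_mult_row_finite[OF assms(1)] sum_distrib_left sum_distrib_right)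
qed

lemma Mat_add: "a \<in> Mat \<delta> \<Longrightarrow> b \<in> Mat \<delta> \<Longrightarrow> imat_add a b \<in> Mat \<delta>"
  by (simp add: mem_Mat_iff corner_entries_add finite_entries_add)

lemma Mat_zero: "imat_zero \<in> Mat \<delta>"
  by (simp add: mem_Mat_iff corner_entries_def imat_zero_def)

lemma Mat_scale: "a \<in> Mat \<delta> \<Longrightarrow> imat_scale s a \<in> Mat \<delta>"
  by (simp add: mem_Mat_iff corner_entries_scale finite_entries_scale)

lemma Mat_adj: "a \<in> Mat \<delta> \<Longrightarrow> imat_adj a \<in> Mat \<delta>"
  by (simp add: mem_Mat_iff corner_entries_adj finite_entries_adj)

lemma Mat_star:
  assumes "a \<in> Mat \<delta>" "b \<in> Mat \<delta>"
  shows "imat_star \<delta> a b \<in> Mat \<delta>"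
proof -
  let ?L = "Lam \<delta> (Lam_sum \<delta> a)"
  note rf = Mat_row_finite[OF assms(1)] Mat_row_finite[OF assms(2)]
  have rfL: "row_finite ?L" using rf by (simp add: row_finite_Lam row_finite_Lam_sum)
  have ca: "corner_entries \<delta> a" and cb: "corner_entries \<delta> b"
    using assms by (simp_all add: mem_Mat_iff)
  have "corner_entries \<delta> (imat_mult a (Lam_sum \<delta> b))"
    using rf ca cb by (simp add: corner_entries_mult corner_entries_Lam_sum)
  moreover have "corner_entries \<delta> (imat_mult ?L b)"
    using rfL ca cb by (simp add: corner_entries_mult corner_entries_Lam_sum corner_entries_Lam)
  moreover have "finite {(i, j). imat_mult a (Lam_sum \<delta> b) i j \<noteq> 0}"
    using assms rf by (simp add: mem_Mat_iff finite_entries_mult row_finite_Lam_sum)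
  moreover have "finite {(i, j). imat_mult ?L b i j \<noteq> 0}"
  proof -
    \<comment> \<open>Here the columns of the left factor must be finite; the adjoint turns them into the rows
      of \<open>\<Lambda>(S(a\<^sup>*))\<close>.\<close>
    have "row_finite (imat_adj ?L)"
      using Mat_row_finite[OF Mat_adj[OF assms(1)]]
      by (simp add: Lam_adj[symmetric] Lam_sum_adj[symmetric] row_finite_Lam row_finite_Lam_sum)
    then have "finite {(i, j). imat_mult (imat_adj b) (imat_adj ?L) i j \<noteq> 0}"
      using Mat_adj[OF assms(2)] by (intro finite_entries_mult) (simp_all add: mem_Mat_iff)
    then have "finite {(i, j). imat_adj (imat_mult ?L b) i j \<noteq> 0}"
      by (simp add: imat_adj_mult[OF rfL])
    then show ?thesis
      using finite_entries_adj imat_adj_adj by metis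
  qed
  ultimately show ?thesis
    by (simp add: imat_star_conv_Lam_sum[OF rf(1)] mem_Mat_iff corner_entries_add finite_entries_add)
qed

end

theorem proposition2p1:
  fixes \<delta> :: "'a::unital_cstar_algebra \<Rightarrow> 'a"
  assumes "cstar_dynamical_system \<delta>"
  shows "involutive_algebra (Mat \<delta>) imat_add imat_zero imat_scale (imat_star \<delta>) imat_adj"
proof -
  interpret cstar_dynamical_system \<delta> by (rule assms)
  note S_simps = Lam_sum_star Lam_sum_add Lam_sum_scale Lam_sum_adj
    Mat_row_finite Mat_add Mat_scale Mat_adj Mat_star row_finite_Lam_sum
  show ?thesis
  proof
    fix a b c :: "'a imat" and s t
    show "imat_add a b = imat_add b a" "imat_add (imat_add a b) c = imat_add a (imat_add b c)"
        "imat_add a imat_zero = a"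
      by (simp_all add: imat_add_def imat_zero_def add_ac)
    show "imat_scale s (imat_add a b) = imat_add (imat_scale s a) (imat_scale s b)"
        "imat_adj (imat_add a b) = imat_add (imat_adj a) (imat_adj b)"
        "imat_adj (imat_scale s a) = imat_scale (cnj s) (imat_adj a)"
        "imat_adj (imat_adj a) = a"
      by (fact imat_scale_add imat_adj_add imat_adj_scale imat_adj_adj)+
    show "imat_scale (s + t) a = imat_add (imat_scale s a) (imat_scale t a)"
        "imat_scale s (imat_scale t a) = imat_scale (s * t) a"
        "imat_scale 1 a = a"
      by (simp_all add: imat_add_def imat_scale_def scaleC_add_left scaleC_scaleC scaleC_one)
    assume a: "a \<in> Mat \<delta>"
    have "imat_add a (imat_scale (- 1) a) = imat_zero"
    proof -
      have "(- 1) *\<^sub>C x = - x" for x :: 'a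
        using scaleR_scaleC[of "- 1" x] by simp
      then show ?thesis by (simp add: imat_add_def imat_scale_def imat_zero_def)
    qed
    then show "\<exists>b\<in>Mat \<delta>. imat_add a b = imat_zero"
      using Mat_scale[OF a] by blast
    assume b: "b \<in> Mat \<delta>"
    show "imat_star \<delta> (imat_scale s a) b = imat_scale s (imat_star \<delta> a b)"
      by (rule Lam_sum_inject) (use a b in \<open>simp add: S_simps imat_mult_scale_left\<close>)
    show "imat_star \<delta> a (imat_scale s b) = imat_scale s (imat_star \<delta> a b)"
      by (rule Lam_sum_inject) (use a b in \<open>simp add: S_simps imat_mult_scale_right\<close>)
    show "imat_adj (imat_star \<delta> a b) = imat_star \<delta> (imat_adj b) (imat_adj a)"
      by (rule Lam_sum_inject) (use a b in \<open>simp add: S_simps imat_adj_mult\<close>)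
    assume c: "c \<in> Mat \<delta>"
    show "imat_star \<delta> (imat_star \<delta> a b) c = imat_star \<delta> a (imat_star \<delta> b c)"
      by (rule Lam_sum_inject) (use a b c in \<open>simp add: S_simps imat_mult_assoc\<close>)
    show "imat_star \<delta> a (imat_add b c) = imat_add (imat_star \<delta> a b) (imat_star \<delta> a c)"
      by (rule Lam_sum_inject) (use a b c in \<open>simp add: S_simps imat_mult_add_right\<close>)
    show "imat_star \<delta> (imat_add a b) c = imat_add (imat_star \<delta> a c) (imat_star \<delta> b c)"
      by (rule Lam_sum_inject) (use a b c in \<open>simp add: S_simps imat_mult_add_left\<close>)
  qed (simp_all add: Mat_add Mat_zero Mat_scale Mat_star Mat_adj)
qed

end
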